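(* There exists a normalized binary goods instance with four agents, five goods, and laminar approval sets in which no ex-ante EQ randomized allocation is ex-post EFX. Consequently, the guarantee that every normalized binary goods instance with laminar approval sets admits a randomized allocation that is ex-ante EF, ex-ante EQ, and ex-post EF1 and EQ1 does not remain true when ex-post EF1 is strengthened to ex-post EFX.
   Context: An instance consists of agents $N=\{1,\dots,n\}$, a finite set $M$ of indivisible items, and for each agent $i$ an additive valuation $v_i:2^M\to\mathbb{R}$, i.e. $v_i(\emptyset)=0$ and $v_i(S)=\sum_{o\in S}v_i(o)$. It is a binary goods instance if $v_i(o)\in\{0,1\}$ for all $i,o$. It is normalized if $v_i(M)=v_j(M)$ for all $i,j\in N$. The approval set of agent $i$ is $\Gamma_i=\{g\in M: v_i(g)=1\}$; the approval sets are laminar if any two of them are disjoint or one contains the other. An allocation $A=(A_1,\dots,A_n)$ is a partition of $M$ into $n$ pairwise disjoint, possibly empty bundles with union $M$. For goods: $A$ is EF1 (respectively EFX) if for all $i,j\in N$ with $A_j\neq\emptyset$, $v_i(A_i)\ge v_i(A_j\setminus\{g\})$ holds for some (respectively every) $g\in A_j$. $A$ is EQ1 if for all $i,j\in N$ with $A_j\neq\emptyset$ there is $g\in A_j$ with $v_i(A_i)\ge v_j(A_j\setminus\{g\})$. A randomized allocation is a probability distribution over deterministic allocations $A^{(1)},\dots,A^{(k)}$ with probabilities $p_1,\dots,p_k\in[0,1]$, $\sum_\ell p_\ell=1$. It is ex-ante EQ if $\sum_\ell p_\ell v_i(A_i^{(\ell)})=\sum_\ell p_\ell v_j(A_j^{(\ell)})$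 for all $i,j\in N$, and ex-ante EF if $\sum_\ell p_\ell v_i(A_i^{(\ell)})\ge\sum_\ell p_\ell v_i(A_j^{(\ell)})$ for all $i,j\in N$. It satisfies a property ex-post if every allocation in its support satisfies that property. *)

theory Defs
  imports "HOL-Probability.Probability_Mass_Function"
begin

text \<open>
  Throughout, \<open>n\<close> is the number of agents, the agents are \<open>1, \<dots>, n\<close>, \<open>M\<close> is the set of items,
  and \<open>v i S\<close> is the value of the bundle \<open>S\<close> for agent \<open>i\<close>.
\<close>

definition agents :: "nat \<Rightarrow> nat set" where
  "agents n = {1..n}"

text \<open>
  At least one agent is required: without agents a nonempty item set has no allocation at all,
  so universally quantified existence claims would fail for a degenerate reason.
\<close>

definition fair_instance :: "nat \<Rightarrow> 'g set \<Rightarrow> (nat \<Rightarrow> 'g set \<Rightarrow> real) \<Rightarrow> bool" where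
  "fair_instance n M v \<longleftrightarrow>
     n \<ge> 1 \<and> finite M \<and>
     (\<forall>i\<in>agents n. v i {} = 0 \<and> (\<forall>S\<subseteq>M. v i S = (\<Sum>g\<in>S. v i {g})))"

definition binary_goods :: "nat \<Rightarrow> 'g set \<Rightarrow> (nat \<Rightarrow> 'g set \<Rightarrow> real) \<Rightarrow> bool" where
  "binary_goods n M v \<longleftrightarrow> (\<forall>i\<in>agents n. \<forall>g\<in>M. v i {g} \<in> {0, 1})"

definition normalized :: "nat \<Rightarrow> 'g set \<Rightarrow> (nat \<Rightarrow> 'g set \<Rightarrow> real) \<Rightarrow> bool" where
  "normalized n M v \<longleftrightarrow> (\<forall>i\<in>agents n. \<forall>j\<in>agents n. v i M = v j M)"

definition approval :: "'g set \<Rightarrow> (nat \<Rightarrow> 'g set \<Rightarrow> real) \<Rightarrow> nat \<Rightarrow> 'g set" where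
  "approval M v i = {g \<in> M. v i {g} = 1}"

definition laminar_approvals :: "nat \<Rightarrow> 'g set \<Rightarrow> (nat \<Rightarrow> 'g set \<Rightarrow> real) \<Rightarrow> bool" where
  "laminar_approvals n M v \<longleftrightarrow>
     (\<forall>i\<in>agents n. \<forall>j\<in>agents n.
        approval M v i \<inter> approval M v j = {} \<or>
        approval M v i \<subseteq> approval M v j \<or>
        approval M v j \<subseteq> approval M v i)"

text \<open>
  An allocation is a function from agents to bundles. Setting it to the empty set outside
  the agents makes the representation unique, so an instance has only finitely many allocations.
\<close>

definition allocation :: "nat \<Rightarrow> 'g set \<Rightarrow> (nat \<Rightarrow> 'g set) \<Rightarrow> bool" where
  "allocation n M A \<longleftrightarrow>
     (\<forall>i\<in>agents n. \<forall>j\<in>agents n. i \<noteq> j \<longrightarrow> A i \<inter> A j = {}) \<and>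
     (\<Union>i\<in>agents n. A i) = M \<and>
     (\<forall>i. i \<notin> agents n \<longrightarrow> A i = {})"

definition EFX :: "nat \<Rightarrow> (nat \<Rightarrow> 'g set \<Rightarrow> real) \<Rightarrow> (nat \<Rightarrow> 'g set) \<Rightarrow> bool" where
  "EFX n v A \<longleftrightarrow>
     (\<forall>i\<in>agents n. \<forall>j\<in>agents n. A j \<noteq> {} \<longrightarrow> (\<forall>g\<in>A j. v i (A i) \<ge> v i (A j - {g})))"

definition EQ1 :: "nat \<Rightarrow> (nat \<Rightarrow> 'g set \<Rightarrow> real) \<Rightarrow> (nat \<Rightarrow> 'g set) \<Rightarrow> bool" where
  "EQ1 n v A \<longleftrightarrow>
     (\<forall>i\<in>agents n. \<forall>j\<in>agents n. A j \<noteq> {} \<longrightarrow> (\<exists>g\<in>A j. v i (A i) \<ge> v j (A j - {g})))"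

definition randomized_allocation :: "nat \<Rightarrow> 'g set \<Rightarrow> (nat \<Rightarrow> 'g set) pmf \<Rightarrow> bool" where
  "randomized_allocation n M P \<longleftrightarrow> (\<forall>A\<in>set_pmf P. allocation n M A)"

text \<open>
  Hence the expectations below are finite sums over the support.
\<close>

lemma finite_set_pmf_randomized_allocation:
  assumes "finite M" and "randomized_allocation n M P"
  shows "finite (set_pmf P)"
proof -
  let ?F = "{A. \<forall>i. (i \<in> agents n \<longrightarrow> A i \<in> Pow M) \<and> (i \<notin> agents n \<longrightarrow> A i = {})}"
  have "A \<in> ?F" if "A \<in> set_pmf P" for A
  proof -
    have alloc: "allocation n M A"
      using assms(2) that by (simp add: randomized_allocation_def)
    then have "A i \<subseteq> M" if "i \<in> agents n" for i
      using that unfolding allocation_def by (metis UN_upper)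
    moreover have "A i = {}" if "i \<notin> agents n" for i
      using alloc that unfolding allocation_def by simp
    ultimately show ?thesis by simp
  qed
  then have "set_pmf P \<subseteq> ?F" by (rule subsetI)
  moreover have "finite (agents n)" by (simp add: agents_def)
  then have "finite ?F" using assms(1) by (intro finite_set_of_finite_funs) simp_all
  ultimately show ?thesis by (rule finite_subset)
qed

definition ex_ante_EQ ::
    "nat \<Rightarrow> (nat \<Rightarrow> 'g set \<Rightarrow> real) \<Rightarrow> (nat \<Rightarrow> 'g set) pmf \<Rightarrow> bool" where
  "ex_ante_EQ n v P \<longleftrightarrow>
     (\<forall>i\<in>agents n. \<forall>j\<in>agents n.
        measure_pmf.expectation P (\<lambda>A. v i (A i)) = measure_pmf.expectation P (\<lambda>A. v j (A j)))"

definition ex_ante_EF ::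
    "nat \<Rightarrow> (nat \<Rightarrow> 'g set \<Rightarrow> real) \<Rightarrow> (nat \<Rightarrow> 'g set) pmf \<Rightarrow> bool" where
  "ex_ante_EF n v P \<longleftrightarrow>
     (\<forall>i\<in>agents n. \<forall>j\<in>agents n.
        measure_pmf.expectation P (\<lambda>A. v i (A i)) \<ge> measure_pmf.expectation P (\<lambda>A. v i (A j)))"

definition ex_post :: "((nat \<Rightarrow> 'g set) \<Rightarrow> bool) \<Rightarrow> (nat \<Rightarrow> 'g set) pmf \<Rightarrow> bool" where
  "ex_post Q P \<longleftrightarrow> (\<forall>A\<in>set_pmf P. Q A)"

end

theory Submission
  imports Defs
begin

text \<open>
  Agents 1, 2, 3 approve the items 0, 1, agent 4 approves the items 2, 3, and nobody approves
  item 4. In an EFX allocation agent 4 always gets an approved item: otherwise envy-freeness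
  forces the bundles holding 2 and 3 to be singletons, their owners are among agents 1, 2, 3
  and have value 0, so the bundles holding 0 and 1 are singletons too, and the five items
  would need five different owners. Hence agent 4 has expected value at least 1, whereas
  agents 1, 2, 3 share only two approved items, so that their common expected value is at
  most 2/3.
\<close>

text \<open>Indices outside the four agents fall into the second case, so the facts about single
  agents below hold for every \<open>i\<close> and the instance lemmas for every
  \<open>n\<close>.\<close>

definition likes :: "nat \<Rightarrow> nat set" where
  "likes i = (if i = 4 then {2, 3} else {0, 1})"

definition likes_value :: "nat \<Rightarrow> nat set \<Rightarrow> real" where
  "likes_value i S = real (card (S \<inter> likes i))"

lemma finite_likes [simp]: "finite (likes i)"
  by (simp add: likes_def)

lemma likes_value_singleton: "likes_value i {g} = (if g \<in> likes i then 1 else 0)"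
  by (simp add: likes_value_def)

lemma approval_likes_value: "likes i \<subseteq> M \<Longrightarrow> approval M likes_value i = likes i"
  by (auto simp: approval_def likes_value_singleton)

lemma fair_instance_likes_value:
  assumes "n \<ge> 1" and "finite M"
  shows "fair_instance n M likes_value"
proof -
  have "likes_value i S = (\<Sum>g\<in>S. likes_value i {g})" if "S \<subseteq> M" for i S
    using finite_subset[OF that assms(2)]
    by (simp add: likes_value_singleton sum.If_cases) (simp add: likes_value_def)
  then show ?thesis
    using assms by (auto simp: fair_instance_def likes_value_def)
qed

lemma binary_goods_likes_value: "binary_goods n M likes_value"
  by (simp add: binary_goods_def likes_value_singleton)

lemma normalized_likes_value:
  assumes "{0, 1, 2, 3} \<subseteq> M"
  shows "normalized n M likes_value"
proof -
  have "likes_value i M = 2" for i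
  proof -
    have "M \<inter> likes i = likes i"
      using assms by (auto simp: likes_def)
    then show ?thesis
      by (simp add: likes_value_def likes_def)
  qed
  then show ?thesis
    by (simp add: normalized_def)
qed

lemma laminar_approvals_likes_value:
  assumes "{0, 1, 2, 3} \<subseteq> M"
  shows "laminar_approvals n M likes_value"
proof -
  have "approval M likes_value i = likes i" for i
    using assms by (intro approval_likes_value) (auto simp: likes_def)
  then show ?thesis
    by (simp add: laminar_approvals_def likes_def)
qed

text \<open>If \<open>A j\<close> held a second item \<open>h\<close>, removing \<open>h\<close>
  would leave \<open>g\<close>, so agent \<open>i\<close> would still value the rest at 1 or more
  while valuing its own bundle at 0.\<close>

lemma EFX_likes_value_singleton:
  assumes "EFX n likes_value A" and "i \<in> agents n" and "A i \<inter> likes i = {}"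
    and "j \<in> agents n" and "g \<in> A j" and "g \<in> likes i"
  shows "A j = {g}"
proof -
  have "h = g" if "h \<in> A j" for h
  proof (rule ccontr)
    assume "h \<noteq> g"
    then have "card ((A j - {h}) \<inter> likes i) \<noteq> 0"
      using assms(5,6) by auto
    moreover have "likes_value i (A j - {h}) \<le> likes_value i (A i)"
      using assms(1,2,4) that unfolding EFX_def by blast
    ultimately show False
      using assms(3) by (simp add: likes_value_def)
  qed
  then show ?thesis
    using assms(5) by blast
qed

lemma EFX_agent4:
  assumes alloc: "allocation 4 {0..<5} A" and efx: "EFX 4 likes_value A"
  shows "likes_value 4 (A 4) \<ge> 1"
proof -
  have "A 4 \<inter> likes 4 \<noteq> {}"
  proof
    assume zero: "A 4 \<inter> likes 4 = {}"
    have "\<exists>i\<in>agents 4. g \<in> A i" if "g \<in> {0..<5}" for g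
      using alloc that unfolding allocation_def by blast
    then obtain owner where owner: "owner g \<in> agents 4" "g \<in> A (owner g)"
      if "g \<in> {0..<5}" for g
      by metis
    have right: "A (owner g) = {g}" if "g \<in> {2, 3}" for g
      using EFX_likes_value_singleton[OF efx _ zero, of "owner g" g] owner[of g] that
      by (auto simp: agents_def likes_def)
    \<comment> \<open>The owner of item 2 is the second envious agent: it holds exactly
      \<open>{2}\<close> and approves \<open>{0, 1}\<close>, so it also has value 0, and its envy
      forces singletons around items 0 and 1.\<close>
    have "owner 2 \<noteq> 4"
      using zero owner(2)[of 2] by (auto simp: likes_def)
    then have "A (owner 2) \<inter> likes (owner 2) = {}"
      using right[of 2] by (simp add: likes_def)
    then have left: "A (owner g) = {g}" if "g \<in> {0, 1}" for g
      using EFX_likes_value_singleton[OF efx, of "owner 2" "owner g" g] owner[of g] owner[of 2]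
        that \<open>owner 2 \<noteq> 4\<close>
      by (auto simp: likes_def)
    have single: "A (owner g) = {g}" if "g \<in> {0..<5}" "g \<noteq> 4" for g
    proof -
      have "g \<in> {0, 1} \<or> g \<in> {2, 3}"
        using that by simp arith
      then show ?thesis
        using left[of g] right[of g] by argo
    qed
    have "inj_on owner {0..<5}"
    proof (rule inj_onI)
      fix g h
      assume gh: "g \<in> {0..<5}" "h \<in> {0..<5}" "owner g = owner h"
      then have "g \<in> A (owner h)" "h \<in> A (owner g)"
        using owner(2)[of g] owner(2)[of h] by simp_all
      \<comment> \<open>If \<open>g\<close> and \<open>h\<close> differ, one of them is not item 4;
        the common owner's bundle is then a singleton, yet it contains both.\<close>
      then show "g = h"
        using single[of g] single[of h] gh(1,2) by (cases "g = 4"; cases "h = 4") simp_all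
    qed
    moreover have "owner ` {0..<5} \<subseteq> agents 4"
      using owner(1) by blast
    ultimately have "card {0..<5::nat} \<le> card (agents 4)"
      by (intro card_inj_on_le) (auto simp: agents_def)
    then show False
      by (simp add: agents_def)
  qed
  then have "1 \<le> card (A 4 \<inter> likes 4)"
    by (simp add: Suc_le_eq card_gt_0_iff)
  then show ?thesis
    by (simp only: likes_value_def real_of_nat_ge_one_iff)
qed

lemma likes_value_sum_le_2:
  assumes "allocation 4 M A"
  shows "likes_value 1 (A 1) + likes_value 2 (A 2) + likes_value 3 (A 3) \<le> 2"
proof -
  have disj: "A 1 \<inter> A 2 = {}" "A 1 \<inter> A 3 = {}" "A 2 \<inter> A 3 = {}"
    using assms by (auto simp: allocation_def agents_def)
  \<comment> \<open>Cutting the bundles down to \<open>{0, 1}\<close> makes them finite although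
    \<open>M\<close> is arbitrary, so the cardinalities of disjoint parts add up.\<close>
  have "card (A 1 \<inter> {0, 1}) + card (A 2 \<inter> {0, 1}) + card (A 3 \<inter> {0, 1})
      = card ((A 1 \<inter> {0, 1}) \<union> (A 2 \<inter> {0, 1}) \<union> (A 3 \<inter> {0, 1}))"
    using disj by (subst card_Un_disjoint; (subst card_Un_disjoint)?; auto)
  also have "\<dots> \<le> card {0, 1 :: nat}"
    by (rule card_mono) auto
  finally show ?thesis
    by (simp add: likes_value_def likes_def)
qed

lemma no_ex_ante_EQ_ex_post_EFX:
  assumes rand: "randomized_allocation 4 {0..<5} P" and eq: "ex_ante_EQ 4 likes_value P"
    and efx: "ex_post (EFX 4 likes_value) P"
  shows False
proof -
  let ?E = "\<lambda>i. measure_pmf.expectation P (\<lambda>A. likes_value i (A i))"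
  have "finite (set_pmf P)"
    using rand by (intro finite_set_pmf_randomized_allocation) auto
  \<comment> \<open>Integrability allows the expectation of the sum to be split and pointwise bounds
    on the support to pass to expectations.\<close>
  then have int [simp]: "integrable (measure_pmf P) f" for f :: "_ \<Rightarrow> real"
    by (rule integrable_measure_pmf_finite)
  have alloc: "allocation 4 {0..<5} A" if "A \<in> set_pmf P" for A
    using rand that by (simp add: randomized_allocation_def)
  have "1 \<le> ?E 4"
    using efx alloc
    by (intro measure_pmf.integral_ge_const) (auto simp: AE_measure_pmf_iff ex_post_def EFX_agent4)
  moreover have "?E 1 + ?E 2 + ?E 3 \<le> 2"
  proof -
    let ?s = "\<lambda>A. likes_value 1 (A 1) + likes_value 2 (A 2) + likes_value 3 (A 3)"
    have "?s A \<le> 2" if "A \<in> set_pmf P" for A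
      by (rule likes_value_sum_le_2[OF alloc[OF that]])
    then have "AE A in measure_pmf P. ?s A \<le> 2"
      unfolding AE_measure_pmf_iff by (rule ballI)
    then have "measure_pmf.expectation P ?s \<le> 2"
      by (intro measure_pmf.integral_le_const int)
    then show ?thesis
      by simp
  qed
  moreover have "?E 1 = ?E 4" "?E 2 = ?E 4" "?E 3 = ?E 4"
    using eq unfolding ex_ante_EQ_def agents_def by auto
  \<comment> \<open>The common expectation \<open>x\<close> would satisfy both 1 \<le> x and 3x
    \<le> 2.\<close>
  ultimately show False
    by linarith
qed

theorem proposition11:
  "(\<exists>(M :: nat set) (v :: nat \<Rightarrow> nat set \<Rightarrow> real).
      fair_instance 4 M v \<and> binary_goods 4 M v \<and> normalized 4 M v \<and> laminar_approvals 4 M v \<and>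
      card M = 5 \<and>
      \<not> (\<exists>P. randomized_allocation 4 M P \<and> ex_ante_EQ 4 v P \<and> ex_post (EFX 4 v) P))
   \<and>
   \<not> (\<forall>n (M :: nat set) (v :: nat \<Rightarrow> nat set \<Rightarrow> real).
        fair_instance n M v \<and> binary_goods n M v \<and> normalized n M v \<and> laminar_approvals n M v \<longrightarrow>
        (\<exists>P. randomized_allocation n M P \<and> ex_ante_EF n v P \<and> ex_ante_EQ n v P \<and>
             ex_post (EFX n v) P \<and> ex_post (EQ1 n v) P))"
proof -
  have inst: "fair_instance 4 {0..<5} likes_value" "binary_goods 4 {0..<5} likes_value"
    "normalized 4 {0..<5} likes_value" "laminar_approvals 4 {0..<5} likes_value"
    by (auto intro!: fair_instance_likes_value binary_goods_likes_value normalized_likes_value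
        laminar_approvals_likes_value)
  moreover have "card {0..<5::nat} = 5"
    by simp
  \<comment> \<open>One instance settles both conjuncts: a distribution promised by the universal
    claim would in particular be ex-ante EQ and ex-post EFX.\<close>
  ultimately show ?thesis
    using no_ex_ante_EQ_ex_post_EFX by blast
qed

end
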